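(* Let $f(z)=\sum_{|\alpha|=d}a(\alpha)z^\alpha\in\mathbb{R}[z_1,\ldots,z_n]$ be a real homogeneous polynomial of degree $d$ which is symmetric in all its variables and has at least one positive coefficient. If $f$ is real stable and $\alpha=(\alpha_1,\ldots,\alpha_n)\in\mathbb{N}^n$ and indices $i,j\in\{1,\ldots,n\}$ are such that $|\alpha|=d$ and $\alpha_i\ge\alpha_j$, then, for integers $k,\ell$, $$\hat a(\alpha+k(e_i-e_j))\le\hat a(\alpha+\ell(e_i-e_j))\quad\text{for } -\alpha_i\le k\le\ell\le\left[\tfrac{\alpha_j-\alpha_i}{2}\right]$$ and $$\hat a(\alpha+k(e_i-e_j))\ge\hat a(\alpha+\ell(e_i-e_j))\quad\text{for } \left[\tfrac{\alpha_j-\alpha_i}{2}\right]\le k\le\ell\le\alpha_j.$$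
   Context: $\mathbb{N}$ is the set of nonnegative integers. Multi-index notation: $z=(z_1,\ldots,z_n)$, $|\alpha|=\sum_{i=1}^n\alpha_i$, $z^\alpha=\prod_{i=1}^n z_i^{\alpha_i}$. $\{e_i\}_{i=1}^n$ is the standard basis of $\mathbb{R}^n$, and $[x]$ denotes the integer part (floor) of $x$. For $\alpha\in\mathbb{N}^n$ with $|\alpha|=d$, $\binom{d}{\alpha}=\frac{d!}{\alpha_1!\cdots\alpha_n!}$, and the normalized coefficients of $f$ are $\hat a(\alpha)=\binom{d}{\alpha}^{-1}a(\alpha)$. A polynomial $f\in\mathbb{R}[z_1,\ldots,z_n]$ is real stable if $f(z_1,\ldots,z_n)\ne0$ for all $(z_1,\ldots,z_n)\in\mathbb{C}^n$ with $\operatorname{Im}(z_j)>0$ for $1\le j\le n$. *)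

theory Defs
  imports Complex_Main "HOL-Library.Poly_Mapping"
begin

text \<open>
  Polynomials in the variables \<open>z\<^sub>i\<close> with \<open>i :: 'n\<close>, where \<open>'n\<close> is a finite type (so \<open>n = CARD('n)\<close>),
  are finitely supported maps from exponent vectors to coefficients. The carrier type and its ring
  structure come from \<^theory>\<open>HOL-Library.Poly_Mapping\<close>; the coefficient \<open>a(\<alpha>)\<close> of \<open>f\<close> is
  \<open>lookup f \<alpha>\<close>.
\<close>

type_synonym 'n multiindex = "'n \<Rightarrow>\<^sub>0 nat"
type_synonym 'n real_mpoly = "'n multiindex \<Rightarrow>\<^sub>0 real"

abbreviation lookup :: "('a \<Rightarrow>\<^sub>0 'b::zero) \<Rightarrow> 'a \<Rightarrow> 'b"
  where "lookup \<equiv> Poly_Mapping.lookup"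

definition total_degree :: "('n::finite) multiindex \<Rightarrow> nat"
  where "total_degree \<alpha> = (\<Sum>i\<in>UNIV. lookup \<alpha> i)"

definition ceval :: "('n::finite) real_mpoly \<Rightarrow> ('n \<Rightarrow> complex) \<Rightarrow> complex"
  where "ceval f z =
    (\<Sum>\<alpha>\<in>Poly_Mapping.keys f. of_real (lookup f \<alpha>) * (\<Prod>i\<in>UNIV. z i ^ lookup \<alpha> i))"

definition homogeneous :: "nat \<Rightarrow> ('n::finite) real_mpoly \<Rightarrow> bool"
  where "homogeneous d f \<longleftrightarrow> (\<forall>\<alpha>\<in>Poly_Mapping.keys f. total_degree \<alpha> = d)"

text \<open>
  The inner \<^const>\<open>Poly_Mapping.map_key\<close> permutes the entries of an exponent vector, the outer one
  permutes the coefficients accordingly: for a bijection \<open>\<pi>\<close> the coefficient of the result at \<open>\<alpha>\<close> is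
  the coefficient of \<open>f\<close> at \<open>\<alpha> \<circ> \<pi>\<close>, so each \<open>z\<^sub>i\<close> is replaced by the variable with index \<open>\<pi> i\<close>.
  Outside bijections \<^const>\<open>Poly_Mapping.map_key\<close> is unspecified; \<open>symmetric\<close> only uses bijections.
\<close>

definition permute_vars :: "('n \<Rightarrow> 'n) \<Rightarrow> ('n::finite) real_mpoly \<Rightarrow> 'n real_mpoly"
  where "permute_vars \<pi> f = Poly_Mapping.map_key (Poly_Mapping.map_key \<pi>) f"

definition symmetric :: "('n::finite) real_mpoly \<Rightarrow> bool"
  where "symmetric f \<longleftrightarrow> (\<forall>\<pi>. bij \<pi> \<longrightarrow> permute_vars \<pi> f = f)"

definition real_stable :: "('n::finite) real_mpoly \<Rightarrow> bool"
  where "real_stable f \<longleftrightarrow> (\<forall>z. (\<forall>j. Im (z j) > 0) \<longrightarrow> ceval f z \<noteq> 0)"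

definition multinomial :: "nat \<Rightarrow> ('n::finite) multiindex \<Rightarrow> real"
  where "multinomial d \<alpha> = fact d / (\<Prod>i\<in>UNIV. fact (lookup \<alpha> i))"

definition normalized_coeff :: "nat \<Rightarrow> ('n::finite) real_mpoly \<Rightarrow> 'n multiindex \<Rightarrow> real"
  where "normalized_coeff d f \<alpha> = inverse (multinomial d \<alpha>) * lookup f \<alpha>"

text \<open>
  \<open>shift \<alpha> k i j\<close> is \<open>\<alpha> + k(e\<^sub>i - e\<^sub>j)\<close>. The sum is formed over the integers; converting back to
  natural numbers loses nothing for \<open>-\<alpha>\<^sub>i \<le> k \<le> \<alpha>\<^sub>j\<close> (\<open>i = j\<close> included), as
  \<open>int_lookup_shift\<close> shows.
\<close>

definition shift :: "('n::finite) multiindex \<Rightarrow> int \<Rightarrow> 'n \<Rightarrow> 'n \<Rightarrow> 'n multiindex"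
  where "shift \<alpha> k i j = Poly_Mapping.map nat
    (Poly_Mapping.map int \<alpha> +
     Poly_Mapping.map ((*) k) (Poly_Mapping.single i 1 - Poly_Mapping.single j 1))"

lemma lookup_permute_vars:
  assumes "bij \<pi>"
  shows "lookup (permute_vars \<pi> f) \<alpha> = lookup f (Poly_Mapping.map_key \<pi> \<alpha>)"
    and "lookup (Poly_Mapping.map_key \<pi> \<alpha>) i = lookup \<alpha> (\<pi> i)"
proof -
  have inj: "inj \<pi>" using assms by (rule bij_is_inj)
  show *: "lookup (Poly_Mapping.map_key \<pi> \<alpha>) i = lookup \<alpha> (\<pi> i)" for \<alpha> :: "'a multiindex" and i
    using inj by (simp add: map_key.rep_eq)
  have "inj (Poly_Mapping.map_key \<pi> :: 'a multiindex \<Rightarrow> _)"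
  proof (rule injI)
    fix \<alpha> \<beta> :: "'a multiindex"
    assume eq: "Poly_Mapping.map_key \<pi> \<alpha> = Poly_Mapping.map_key \<pi> \<beta>"
    show "\<alpha> = \<beta>"
    proof (rule poly_mapping_eqI)
      fix x
      obtain y where "x = \<pi> y" using assms by (metis bij_pointE)
      then show "lookup \<alpha> x = lookup \<beta> x" using eq * by metis
    qed
  qed
  then show "lookup (permute_vars \<pi> f) \<alpha> = lookup f (Poly_Mapping.map_key \<pi> \<alpha>)"
    by (simp add: permute_vars_def map_key.rep_eq)
qed

lemma int_lookup_shift:
  assumes "- int (lookup \<alpha> i) \<le> k" "k \<le> int (lookup \<alpha> j)"
  shows "int (lookup (shift \<alpha> k i j) m) =
    int (lookup \<alpha> m) + k * ((if m = i then 1 else 0) - (if m = j then 1 else 0))"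
  using assms
  by (auto simp: shift_def Poly_Mapping.map.rep_eq lookup_add lookup_minus lookup_single when_def)

end

theory Submission
  imports Defs "HOL-Computational_Algebra.Fundamental_Theorem_Algebra"
begin

text \<open>
  With \<open>A\<close> the normalized coefficients, \<open>f(z) = (D\<^sub>z)\<^sup>d A 0\<close>, where
  \<open>D\<^sub>v A \<gamma> = \<Sum>\<^sub>m v\<^sub>m A(\<gamma> + e\<^sub>m)\<close> is, up to the factor \<open>d\<close>, the directional derivative of the form
  with normalized coefficients \<open>A\<close>. For a direction \<open>v\<close> with positive entries, \<open>t \<mapsto> f(z + tv)\<close> has
  degree exactly \<open>d\<close> and all its roots in the open lower half plane when \<open>z\<close> lies in the upper one,
  so \<open>D\<^sub>v\<close> preserves stability without any limiting argument. Hence the polarized values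
  \<open>D\<^bsub>v1\<^esub> \<dots> D\<^bsub>vd\<^esub> A 0\<close> at positive directions never vanish, have a constant sign, and are log-concave
  because a stable binary quadratic form has nonnegative discriminant. Taking the directions
  \<open>e\<^sub>m + \<epsilon>(1,\<dots>,1)\<close> makes these sequences strictly positive, so there are no internal zeros; as
  \<open>\<epsilon> \<rightarrow> 0\<close> they tend to the normalized coefficients, and \<open>g s g(t+1) \<le> g(s+1) g t\<close> for \<open>s \<le> t\<close> survives
  the limit. Together with \<open>g(p - s) = g s\<close> this gives unimodality.
\<close>

section \<open>Iterated derivatives of coefficient arrays\<close>

text \<open>The scalars stay general because real, complex and polynomial ones all occur
  below.\<close>

definition dir_deriv ::
    "('n::finite \<Rightarrow> 'a::comm_semiring_1) \<Rightarrow> ('n multiindex \<Rightarrow> 'a) \<Rightarrow> 'n multiindex \<Rightarrow> 'a"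
  where "dir_deriv v A \<gamma> = (\<Sum>m\<in>UNIV. v m * A (\<gamma> + Poly_Mapping.single m 1))"

lemma dir_deriv_commute: "dir_deriv u (dir_deriv v A) = dir_deriv v (dir_deriv u A)"
proof
  fix \<gamma>
  have "dir_deriv u (dir_deriv v A) \<gamma> =
      (\<Sum>m\<in>UNIV. \<Sum>l\<in>UNIV. u m * v l * A (\<gamma> + Poly_Mapping.single m 1 + Poly_Mapping.single l 1))"
    by (simp add: dir_deriv_def sum_distrib_left mult.assoc)
  also have "\<dots> = (\<Sum>l\<in>UNIV. \<Sum>m\<in>UNIV. v l * u m * A (\<gamma> + Poly_Mapping.single l 1 + Poly_Mapping.single m 1))"
    by (subst sum.swap) (simp add: ac_simps)
  also have "\<dots> = dir_deriv v (dir_deriv u A) \<gamma>"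
    by (simp add: dir_deriv_def sum_distrib_left mult.assoc)
  finally show "dir_deriv u (dir_deriv v A) \<gamma> = dir_deriv v (dir_deriv u A) \<gamma>" .
qed

lemma dir_deriv_funpow_commute:
  "dir_deriv u ((dir_deriv v ^^ k) A) = (dir_deriv v ^^ k) (dir_deriv u A)"
  by (induction k) (auto simp: dir_deriv_commute[of u v])

lemma dir_deriv_foldr_commute:
  "dir_deriv u (foldr dir_deriv vs A) = foldr dir_deriv vs (dir_deriv u A)"
  by (induction vs) (auto simp: dir_deriv_commute[of u])

lemma dir_deriv_sum:
  "dir_deriv v (\<lambda>\<gamma>. \<Sum>x\<in>S. c x * B x \<gamma>) = (\<lambda>\<gamma>. \<Sum>x\<in>S. c x * dir_deriv v (B x) \<gamma>)"
proof
  fix \<gamma>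
  show "dir_deriv v (\<lambda>\<gamma>. \<Sum>x\<in>S. c x * B x \<gamma>) \<gamma> = (\<Sum>x\<in>S. c x * dir_deriv v (B x) \<gamma>)"
    unfolding dir_deriv_def sum_distrib_left
    by (subst sum.swap) (simp add: ac_simps)
qed

lemma dir_deriv_funpow_sum:
  "(dir_deriv v ^^ k) (\<lambda>\<gamma>. \<Sum>x\<in>S. c x * B x \<gamma>) = (\<lambda>\<gamma>. \<Sum>x\<in>S. c x * (dir_deriv v ^^ k) (B x) \<gamma>)"
  by (induction k) (auto simp: dir_deriv_sum)

lemma dir_deriv_scale_left: "dir_deriv (\<lambda>m. c * v m) A \<gamma> = c * dir_deriv v A \<gamma>"
  by (simp add: dir_deriv_def sum_distrib_left mult.assoc)

lemma dir_deriv_scale_right: "dir_deriv v (\<lambda>\<gamma>. c * A \<gamma>) \<gamma> = c * dir_deriv v A \<gamma>"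
  by (simp add: dir_deriv_def sum_distrib_left ac_simps)

lemma dir_deriv_funpow_scale_left:
  "(dir_deriv (\<lambda>m. c * v m) ^^ k) A = (\<lambda>\<gamma>. c ^ k * (dir_deriv v ^^ k) A \<gamma>)"
proof (induction k)
  case (Suc k)
  then show ?case
    by (intro ext) (simp add: dir_deriv_scale_left dir_deriv_scale_right mult.assoc)
qed simp

lemma dir_deriv_add_left:
  "dir_deriv (\<lambda>m. u m + v m) A \<gamma> = dir_deriv u A \<gamma> + dir_deriv v A \<gamma>"
  by (simp add: dir_deriv_def distrib_right sum.distrib)

lemma dir_deriv_of_real:
  "dir_deriv (\<lambda>m. complex_of_real (v m)) (\<lambda>\<gamma>. complex_of_real (A \<gamma>)) =
    (\<lambda>\<gamma>. complex_of_real (dir_deriv v A \<gamma>))"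
  by (intro ext) (simp add: dir_deriv_def)

lemma dir_deriv_funpow_of_real:
  "(dir_deriv (\<lambda>m. complex_of_real (v m)) ^^ k) (\<lambda>\<gamma>. complex_of_real (A \<gamma>)) =
    (\<lambda>\<gamma>. complex_of_real ((dir_deriv v ^^ k) A \<gamma>))"
  by (induction k) (auto simp: dir_deriv_of_real)

section \<open>Restriction of a form to a line\<close>

text \<open>The polynomial entries \<open>[:z m, v m:]\<close> encode the point z + t v with t as an
  indeterminate, so one iterated derivative yields the whole restriction to this line.\<close>

lemma poly_dir_deriv_funpow:
  fixes z v :: "'n::finite \<Rightarrow> 'a::comm_ring_1"
  shows "poly ((dir_deriv (\<lambda>m. [:z m, v m:]) ^^ k) (\<lambda>\<gamma>. [:A \<gamma>:]) \<gamma>) t =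
    (dir_deriv (\<lambda>m. z m + t * v m) ^^ k) A \<gamma>"
  by (induction k arbitrary: \<gamma>) (auto simp: dir_deriv_def poly_sum algebra_simps)

text \<open>This is the binomial theorem for (D_z + t D_v)^k, valid because the operators commute.
  For l > k the binomial coefficient is zero, so the truncated exponent \<open>k - l\<close> does no
  harm.\<close>

lemma coeff_dir_deriv_funpow:
  fixes z v :: "'n::finite \<Rightarrow> 'a::comm_ring_1"
  shows "coeff ((dir_deriv (\<lambda>m. [:z m, v m:]) ^^ k) (\<lambda>\<gamma>. [:A \<gamma>:]) \<gamma>) l =
    of_nat (k choose l) * (dir_deriv v ^^ l) ((dir_deriv z ^^ (k - l)) A) \<gamma>"
proof (induction k arbitrary: l \<gamma>)
  case 0
  then show ?case by (cases l) auto
next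
  case (Suc k)
  let ?q = "(dir_deriv (\<lambda>m. [:z m, v m:]) ^^ k) (\<lambda>\<gamma>. [:A \<gamma>:])"
  show ?case
  proof (cases l)
    case 0
    then show ?thesis using Suc[of _ 0] by (simp add: dir_deriv_def[of _ ?q] coeff_sum)
        (simp add: dir_deriv_def)
  next
    case (Suc l')
    have "coeff ((dir_deriv (\<lambda>m. [:z m, v m:]) ^^ Suc k) (\<lambda>\<gamma>. [:A \<gamma>:]) \<gamma>) l =
        dir_deriv z (\<lambda>\<gamma>. coeff (?q \<gamma>) (Suc l')) \<gamma> + dir_deriv v (\<lambda>\<gamma>. coeff (?q \<gamma>) l') \<gamma>"
      by (simp add: Suc dir_deriv_def[of _ ?q] coeff_sum sum.distrib)
        (simp add: dir_deriv_def)
    also have "dir_deriv z (\<lambda>\<gamma>. coeff (?q \<gamma>) (Suc l')) \<gamma> =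
        of_nat (k choose Suc l') * (dir_deriv v ^^ Suc l') ((dir_deriv z ^^ (k - l')) A) \<gamma>"
    proof (cases "Suc l' \<le> k")
      case True
      then have "k - l' = Suc (k - Suc l')" by simp
      then have "(dir_deriv v ^^ Suc l') ((dir_deriv z ^^ (k - l')) A) =
          dir_deriv z ((dir_deriv v ^^ Suc l') ((dir_deriv z ^^ (k - Suc l')) A))"
        by (simp only: dir_deriv_funpow_commute[of z _ v] funpow.simps(2)[of "k - Suc l'" "dir_deriv z"] o_apply)
      then show ?thesis
        by (simp only: Suc.IH dir_deriv_scale_right)
    next
      case False
      then show ?thesis by (simp add: Suc.IH binomial_eq_0 dir_deriv_def)
    qed
    also have "dir_deriv v (\<lambda>\<gamma>. coeff (?q \<gamma>) l') \<gamma> =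
        of_nat (k choose l') * (dir_deriv v ^^ Suc l') ((dir_deriv z ^^ (k - l')) A) \<gamma>"
      by (simp add: Suc.IH dir_deriv_scale_right)
    finally show ?thesis
      by (simp add: Suc distrib_right)
  qed
qed

text \<open>The quotient is the logarithmic derivative at \<open>0\<close>, that is the sum of \<open>-1/r\<close> over the roots \<open>r\<close>.\<close>

lemma Im_coeff_ratio:
  fixes p :: "complex poly"
  assumes "\<And>t. Im t \<ge> 0 \<Longrightarrow> poly p t \<noteq> 0"
  shows "Im (coeff p 1 / coeff p 0) \<le> 0 \<and> (degree p > 0 \<longrightarrow> Im (coeff p 1 / coeff p 0) < 0)"
  using assms
proof (induction "degree p" arbitrary: p)
  case 0
  then have "coeff p 1 = 0" by (simp add: coeff_eq_0)
  then show ?case using 0 by simp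
next
  case (Suc n)
  then have "\<not> constant (poly p)" by (simp add: constant_degree)
  then obtain r where r: "poly p r = 0" using fundamental_theorem_of_algebra by blast
  then obtain q where q: "p = [:-r, 1:] * q" by (auto simp: poly_eq_0_iff_dvd dvd_def)
  have Im_r: "Im r < 0" using r Suc.prems by force
  have "q \<noteq> 0" using q Suc.hyps(2) by auto
  then have "degree q = n" using Suc.hyps(2) unfolding q by (subst (asm) degree_mult_eq) auto
  moreover have nz: "poly q t \<noteq> 0" if "Im t \<ge> 0" for t
    using Suc.prems[OF that] q by auto
  ultimately have IH: "Im (coeff q 1 / coeff q 0) \<le> 0" using Suc.hyps(1)[of q] by blast
  have q0: "coeff q 0 \<noteq> 0" using nz[of 0] by (simp add: poly_0_coeff_0)
  have r0: "r \<noteq> 0" using Im_r by auto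
  have "coeff p 1 / coeff p 0 = coeff q 1 / coeff q 0 - 1 / r"
    using q0 r0 by (simp add: q field_simps)
  moreover have "Im (1 / r) > 0"
    using Im_r by (simp add: Im_divide divide_pos_pos sum_power2_gt_zero_iff zero_less_mult_iff
        divide_less_0_iff)
  ultimately show ?case using IH by simp
qed

section \<open>Stable forms: derivatives, signs and log-concavity\<close>

text \<open>By \<open>ceval_eq_dir_deriv\<close> this is real stability of the form with normalized
  coefficients \<open>A\<close>. After d derivatives at 0 only entries of total degree d are read,
  so homogeneity is built in.\<close>

definition stable_form :: "nat \<Rightarrow> (('n::finite) multiindex \<Rightarrow> real) \<Rightarrow> bool"
  where "stable_form d A \<longleftrightarrow>
    (\<forall>z. (\<forall>m. Im (z m) > 0) \<longrightarrow> (dir_deriv z ^^ d) (\<lambda>\<gamma>. complex_of_real (A \<gamma>)) 0 \<noteq> 0)"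

text \<open>The point i v has positive imaginary parts, and homogeneity pulls out the factor
  i^d.\<close>

lemma stable_form_funpow_nonzero:
  assumes "stable_form d A" "\<And>m. v m > 0"
  shows "(dir_deriv v ^^ d) A 0 \<noteq> 0"
proof -
  have "(dir_deriv (\<lambda>m. \<i> * complex_of_real (v m)) ^^ d) (\<lambda>\<gamma>. complex_of_real (A \<gamma>)) 0 \<noteq> 0"
    using assms unfolding stable_form_def by simp
  then show ?thesis
    by (simp add: dir_deriv_funpow_scale_left dir_deriv_funpow_of_real)
qed

text \<open>Up to the factor d + 1, the new form at z is the linear coefficient of p, the
  restriction of the old one to z + t v. The top coefficient of p is the nonzero value at v, so p is
  nonconstant; having no root with Im t \<ge> 0, it has a nonzero linear coefficient by
  \<open>Im_coeff_ratio\<close>.\<close>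

lemma stable_form_dir_deriv:
  assumes A: "stable_form (Suc d) A" and v: "\<And>m. v m > 0"
  shows "stable_form d (dir_deriv v A)"
  unfolding stable_form_def
proof (intro allI impI)
  fix z :: "'a \<Rightarrow> complex"
  assume z: "\<forall>m. Im (z m) > 0"
  let ?A = "\<lambda>\<gamma>. complex_of_real (A \<gamma>)"
  let ?v = "\<lambda>m. complex_of_real (v m)"
  define p where "p = (dir_deriv (\<lambda>m. [:z m, ?v m:]) ^^ Suc d) (\<lambda>\<gamma>. [:?A \<gamma>:]) 0"
  have "poly p t \<noteq> 0" if "Im t \<ge> 0" for t
  proof -
    have "Im (z m + t * ?v m) > 0" for m
      using z v[of m] that by (simp add: add_pos_nonneg)
    then show ?thesis
      using A unfolding p_def poly_dir_deriv_funpow stable_form_def by (metis (no_types, lifting))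
  qed
  note nz = this
  have "coeff p (Suc d) \<noteq> 0"
    using stable_form_funpow_nonzero[OF A v]
    by (simp add: p_def coeff_dir_deriv_funpow dir_deriv_funpow_of_real dir_deriv_of_real
        del: funpow.simps)
  then have "degree p > 0"
    using le_degree[of p "Suc d"] by simp
  with Im_coeff_ratio[OF nz] have "coeff p 1 \<noteq> 0" by force
  moreover have "coeff p 1 = of_nat (Suc d) * (dir_deriv z ^^ d) (dir_deriv ?v ?A) 0"
    unfolding p_def by (subst coeff_dir_deriv_funpow) (simp add: dir_deriv_funpow_commute)
  ultimately show "(dir_deriv z ^^ d) (\<lambda>\<gamma>. complex_of_real (dir_deriv v A \<gamma>)) 0 \<noteq> 0"
    by (simp add: dir_deriv_of_real)
qed

lemma stable_form_foldr:
  assumes "stable_form (length vs + d) A" "\<And>v m. v \<in> set vs \<Longrightarrow> v m > 0"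
  shows "stable_form d (foldr dir_deriv vs A)"
  using assms
proof (induction vs arbitrary: A d)
  case (Cons v vs)
  have "stable_form (Suc d) (foldr dir_deriv vs A)"
    using Cons by simp
  then show ?case using Cons.prems(2) by (simp add: stable_form_dir_deriv)
qed simp

text \<open>The first direction is changed from v to w with the others fixed; the induction
  hypothesis for D_w A then changes the rest.\<close>

lemma foldr_dir_deriv_same_sign:
  assumes "stable_form d A" "length vs = d" "length ws = d"
    "\<And>v m. v \<in> set vs \<union> set ws \<Longrightarrow> v m > 0"
  shows "foldr dir_deriv vs A 0 * foldr dir_deriv ws A 0 > 0"
  using assms
proof (induction d arbitrary: A vs ws)
  case 0
  then have "A 0 \<noteq> 0" using stable_form_funpow_nonzero[of 0 A "\<lambda>_. 1"] by simp
  with 0 show ?case by (simp add: zero_less_mult_iff linorder_neq_iff disj_commute)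
next
  case (Suc d)
  obtain v vs' where vs: "vs = v # vs'" using Suc.prems by (cases vs) auto
  obtain w ws' where ws: "ws = w # ws'" using Suc.prems by (cases ws) auto
  let ?F = "\<lambda>u. foldr dir_deriv vs' (dir_deriv u A) 0"
  have F: "?F u = dir_deriv u (foldr dir_deriv vs' A) 0" for u
    by (simp add: dir_deriv_foldr_commute)
  have nz: "?F u \<noteq> 0" if "\<And>m. u m > 0" for u
  proof -
    \<comment> \<open>Once every direction has been applied, stability in degree 0 just says that
      the value is nonzero.\<close>
    have "stable_form 0 (foldr dir_deriv vs' (dir_deriv u A))"
      using Suc.prems vs that by (intro stable_form_foldr stable_form_dir_deriv) auto
    then show ?thesis using stable_form_funpow_nonzero[of 0 _ "\<lambda>_. 1"] by fastforce
  qed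
  have pos: "v m > 0" "w m > 0" for m using Suc.prems(4) vs ws by auto
  have "?F v * ?F w > 0"
  proof (rule ccontr)
    assume "\<not> ?thesis"
    moreover have "?F v \<noteq> 0" "?F w \<noteq> 0" using nz pos by auto
    ultimately have neg: "?F v * ?F w < 0" by (simp add: not_less le_less)
    \<comment> \<open>The value is linear in the direction, so opposite signs at \<open>v\<close> and \<open>w\<close> force a zero in between.\<close>
    define a where "a = \<bar>?F w\<bar>"
    define b where "b = \<bar>?F v\<bar>"
    have ab: "a > 0" "b > 0" using neg by (auto simp: a_def b_def)
    have "a * v m + b * w m > 0" for m using pos ab by (simp add: add_pos_pos)
    then have "?F (\<lambda>m. a * v m + b * w m) \<noteq> 0" by (rule nz)
    moreover have "?F (\<lambda>m. a * v m + b * w m) = a * ?F v + b * ?F w"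
      by (simp only: F dir_deriv_add_left dir_deriv_scale_left)
    moreover have "a * ?F v + b * ?F w = 0"
      using neg by (auto simp: a_def b_def abs_if mult_less_0_iff)
    ultimately show False by simp
  qed
  moreover have "?F w * foldr dir_deriv ws' (dir_deriv w A) 0 > 0"
    using Suc.prems vs ws pos by (intro Suc.IH stable_form_dir_deriv) auto
  ultimately have "?F v * foldr dir_deriv ws' (dir_deriv w A) 0 > 0"
    by (auto simp: zero_less_mult_iff)
  then show ?case
    by (simp add: vs ws dir_deriv_foldr_commute)
qed

text \<open>Otherwise the restriction of the quadratic form to u + t v would have a root with Im t >
  0, at which all imaginary parts of u + t v are positive.\<close>

lemma stable_form_log_concave:
  assumes A: "stable_form 2 A" and v: "\<And>m. v m > 0"
  shows "dir_deriv u (dir_deriv u A) 0 * dir_deriv v (dir_deriv v A) 0 \<le> (dir_deriv u (dir_deriv v A) 0)\<^sup>2"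
proof (rule ccontr)
  define a b c where "a = dir_deriv u (dir_deriv u A) 0" and "b = dir_deriv u (dir_deriv v A) 0"
    and "c = dir_deriv v (dir_deriv v A) 0"
  assume "\<not> ?thesis"
  then have disc: "a * c - b\<^sup>2 > 0" by (simp add: a_def b_def c_def)
  then have c: "c \<noteq> 0" by auto
  \<comment> \<open>A nonreal root of a + 2 b t + c t^2; dividing by \<open>\<bar>c\<bar>\<close>
    instead of \<open>c\<close> selects the one in the upper half plane for either sign of
    \<open>c\<close>.\<close>
  define t where "t = Complex (- b / c) (sqrt (a * c - b\<^sup>2) / \<bar>c\<bar>)"
  let ?A = "\<lambda>\<gamma>. complex_of_real (A \<gamma>)"
  let ?u = "\<lambda>m. complex_of_real (u m)"
  let ?v = "\<lambda>m. complex_of_real (v m)"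
  have "Im t > 0" using disc c by (simp add: t_def)
  then have "(dir_deriv (\<lambda>m. ?u m + t * ?v m) ^^ 2) ?A 0 \<noteq> 0"
    using A v unfolding stable_form_def by simp
  moreover have "(dir_deriv (\<lambda>m. ?u m + t * ?v m) ^^ 2) ?A 0 = a + 2 * t * b + t\<^sup>2 * c"
  proof -
    have D: "dir_deriv (\<lambda>m. ?u m + t * ?v m) B = (\<lambda>\<gamma>. dir_deriv ?u B \<gamma> + t * dir_deriv ?v B \<gamma>)" for B
      by (intro ext) (simp add: dir_deriv_add_left dir_deriv_scale_left)
    have add: "dir_deriv w (\<lambda>\<gamma>. B \<gamma> + t * C \<gamma>) 0 = dir_deriv w B 0 + t * dir_deriv w C 0"
      for w :: "'a \<Rightarrow> complex" and B C
      by (simp add: dir_deriv_def sum.distrib sum_distrib_left distrib_left ac_simps)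
    show ?thesis
      by (simp add: numeral_2_eq_2 D add dir_deriv_of_real a_def b_def c_def
          dir_deriv_commute[of v u] algebra_simps power2_eq_square)
  qed
  moreover have "a + 2 * t * b + t\<^sup>2 * c = 0"
  proof -
    have sq: "(sqrt (a * c - b\<^sup>2))\<^sup>2 = a * c - b\<^sup>2" using disc by simp
    show ?thesis
      using c sq by (auto simp: complex_eq_iff t_def power2_eq_square field_simps)
  qed
  ultimately show False by simp
qed

section \<open>Log-concave and symmetric sequences\<close>

text \<open>By positivity the ratios x (s + 1) / x s decrease. The conclusion avoids division so
  that it can pass to a limit with zero entries.\<close>

lemma log_concave_cross:
  fixes x :: "nat \<Rightarrow> real"
  assumes pos: "\<And>s. s \<le> p \<Longrightarrow> x s > 0"
    and lc: "\<And>s. s + 2 \<le> p \<Longrightarrow> x s * x (s + 2) \<le> (x (s + 1))\<^sup>2"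
    and "s \<le> t" "t < p"
  shows "x s * x (Suc t) \<le> x (Suc s) * x t"
  using \<open>s \<le> t\<close> \<open>t < p\<close>
proof (induction t rule: dec_induct)
  case (step t)
  \<comment> \<open>The induction hypothesis times log-concavity at \<open>t\<close>; the positive
    factor \<open>x t * x (Suc t)\<close> is cancelled afterwards.\<close>
  have "(x s * x (Suc t)) * (x t * x (Suc (Suc t))) \<le> (x (Suc s) * x t) * (x (Suc t))\<^sup>2"
    using step lc[of t] pos by (intro mult_mono[of "x s * x (Suc t)"]) (auto intro!: mult_nonneg_nonneg less_imp_le)
  then have "(x s * x (Suc (Suc t))) * (x t * x (Suc t)) \<le> (x (Suc s) * x (Suc t)) * (x t * x (Suc t))"
    by (simp add: power2_eq_square ac_simps)
  moreover have "x t * x (Suc t) > 0" using pos step.prems by simp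
  ultimately show ?case by (meson mult_le_cancel_right_pos)
qed (simp add: mult.commute)

text \<open>At t = p - s - 1 the cross inequality and the symmetry give g(s)^2 \<le> g(s+1)^2. For
  odd p the bound p \<le> 2 s + 1 lets the descent start at the left one of the two middle entries,
  which agree by symmetry.\<close>

lemma symmetric_unimodal:
  fixes g :: "nat \<Rightarrow> real"
  assumes nonneg: "\<And>s. s \<le> p \<Longrightarrow> g s \<ge> 0"
    and sym: "\<And>s. s \<le> p \<Longrightarrow> g (p - s) = g s"
    and cross: "\<And>s t. s \<le> t \<Longrightarrow> t < p \<Longrightarrow> g s * g (Suc t) \<le> g (Suc s) * g t"
  shows "s \<le> t \<Longrightarrow> 2 * t \<le> p \<Longrightarrow> g s \<le> g t"
    and "s \<le> t \<Longrightarrow> p \<le> 2 * s + 1 \<Longrightarrow> t \<le> p \<Longrightarrow> g t \<le> g s"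
proof -
  have up: "g s \<le> g (Suc s)" if "2 * s + 1 \<le> p" for s
  proof -
    have "g s * g (Suc (p - Suc s)) \<le> g (Suc s) * g (p - Suc s)"
      using that by (intro cross) auto
    moreover have "g (Suc (p - Suc s)) = g s"
      using sym[of s] that by (simp add: Suc_diff_Suc)
    moreover have "g (p - Suc s) = g (Suc s)"
      using sym[of "Suc s"] that by simp
    ultimately have sq: "(g s)\<^sup>2 \<le> (g (Suc s))\<^sup>2" by (simp add: power2_eq_square)
    have "g (Suc s) \<ge> 0" using that by (intro nonneg) simp
    with sq show ?thesis by (rule power2_le_imp_le)
  qed
  show "g s \<le> g t" if "s \<le> t" "2 * t \<le> p"
    using that
  proof (induction t rule: dec_induct)
    case (step t)
    then show ?case using up[of t] by simp
  qed simp
  show "g t \<le> g s" if "s \<le> t" "p \<le> 2 * s + 1" "t \<le> p"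
    using that
  proof (induction t rule: dec_induct)
    case (step t)
    \<comment> \<open>The step from t to t + 1 is the mirror image of an ascending step in the left
      half.\<close>
    have "g (p - Suc t) \<le> g (Suc (p - Suc t))"
      using step by (intro up) auto
    then show ?case
      using step sym[of t] sym[of "Suc t"] by (simp add: Suc_diff_Suc)
  qed simp
qed

section \<open>Multi-indices as lists, and tilted basis directions\<close>

lemma total_degree_add: "total_degree (\<alpha> + \<beta>) = total_degree \<alpha> + total_degree \<beta>"
  by (simp add: total_degree_def lookup_add sum.distrib)

lemma total_degree_single: "total_degree (Poly_Mapping.single m k) = k"
  by (simp add: total_degree_def lookup_single when_def)

lemma multiindex_decomp:
  assumes "lookup \<gamma> m > (0::nat)"
  shows "\<gamma> - Poly_Mapping.single m 1 + Poly_Mapping.single m 1 = \<gamma>"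
  using assms by (intro poly_mapping_eqI) (auto simp: lookup_add lookup_minus lookup_single when_def)

text \<open>A list supplies one unit vector per derivative, so mapping its entries to directions
  gives an argument for \<open>foldr dir_deriv\<close>.\<close>

definition multiindex_of :: "('n::finite) list \<Rightarrow> 'n multiindex"
  where "multiindex_of L = (\<Sum>m\<leftarrow>L. Poly_Mapping.single m 1)"

lemma multiindex_of_simps [simp]:
  "multiindex_of [] = 0"
  "multiindex_of (m # L) = Poly_Mapping.single m 1 + multiindex_of L"
  "multiindex_of (L @ L') = multiindex_of L + multiindex_of L'"
  "multiindex_of (replicate k m) = Poly_Mapping.single m k"
proof -
  show "multiindex_of (replicate k m) = Poly_Mapping.single m k"
    by (induction k) (simp_all add: multiindex_of_def flip: single_add)
qed (simp_all add: multiindex_of_def)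

lemma ex_multiindex_of: "\<exists>L. multiindex_of L = \<beta> \<and> length L = total_degree \<beta>"
proof (induction "total_degree \<beta>" arbitrary: \<beta>)
  case 0
  then have "\<beta> = 0" by (intro poly_mapping_eqI) (simp add: total_degree_def)
  then show ?case using 0 by (intro exI[of _ "[]"]) simp
next
  case (Suc k)
  then obtain m where "lookup \<beta> m > 0"
    by (metis total_degree_def gr0I nat.distinct(1) sum.neutral)
  from multiindex_decomp[OF this] obtain \<gamma> where \<gamma>: "\<beta> = \<gamma> + Poly_Mapping.single m 1" by metis
  with Suc.hyps(2) have "k = total_degree \<gamma>"
    by (simp add: total_degree_add total_degree_single)
  from Suc.hyps(1)[OF this] obtain L where "multiindex_of L = \<gamma>" "length L = total_degree \<gamma>" by blast
  then show ?case
    using \<gamma> by (intro exI[of _ "m # L"]) (simp add: total_degree_add total_degree_single add.commute)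
qed

definition tilt :: "real \<Rightarrow> 'n \<Rightarrow> 'n \<Rightarrow> real"
  where "tilt \<epsilon> m l = of_bool (l = m) + \<epsilon>"

text \<open>At \<epsilon> = 0 each direction is a basis vector e_m, whose derivative merely shifts
  the argument by e_m; the rest is continuity of finite sums.\<close>

lemma tendsto_foldr_tilt:
  "((\<lambda>\<epsilon>. foldr dir_deriv (map (tilt \<epsilon>) L) A \<gamma>) \<longlongrightarrow> A (\<gamma> + multiindex_of L)) (at_right 0)"
proof (induction L arbitrary: \<gamma>)
  case (Cons m L)
  have tilt [tendsto_intros]: "((\<lambda>\<epsilon>. tilt \<epsilon> m l) \<longlongrightarrow> of_bool (l = m) + 0) (at_right 0)" for l
    unfolding tilt_def by (intro tendsto_intros)
  have "((\<lambda>\<epsilon>. dir_deriv (tilt \<epsilon> m) (foldr dir_deriv (map (tilt \<epsilon>) L) A) \<gamma>) \<longlongrightarrow>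
      (\<Sum>l\<in>UNIV. (of_bool (l = m) + 0) * A (\<gamma> + Poly_Mapping.single l 1 + multiindex_of L))) (at_right 0)"
    by (simp only: dir_deriv_def) (intro tendsto_intros Cons)
  then show ?case by (simp add: if_distrib ac_simps)
qed simp

lemma tilt_pos: "\<epsilon> > 0 \<Longrightarrow> tilt \<epsilon> m l > 0"
  by (simp add: tilt_def)

section \<open>Positivity and cross inequalities in the limit\<close>

text \<open>One positive coefficient decides the common sign, since it is a limit of values at
  positive directions.\<close>

lemma foldr_dir_deriv_pos:
  assumes A: "stable_form d A" and \<beta>: "A \<beta> > 0" "total_degree \<beta> = d"
    and vs: "length vs = d" "\<And>v m. v \<in> set vs \<Longrightarrow> v m > 0"
  shows "foldr dir_deriv vs A 0 > 0"
proof -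
  obtain L where L: "multiindex_of L = \<beta>" "length L = d" using ex_multiindex_of \<beta> by metis
  have "((\<lambda>\<epsilon>. foldr dir_deriv vs A 0 * foldr dir_deriv (map (tilt \<epsilon>) L) A 0) \<longlongrightarrow>
      foldr dir_deriv vs A 0 * A (0 + multiindex_of L)) (at_right 0)"
    by (intro tendsto_intros tendsto_foldr_tilt)
  moreover have "\<forall>\<^sub>F \<epsilon> in at_right 0.
      foldr dir_deriv vs A 0 * foldr dir_deriv (map (tilt \<epsilon>) L) A 0 \<ge> 0"
    using eventually_at_right_less[of 0]
  proof eventually_elim
    case (elim \<epsilon>)
    show ?case
      using vs L elim
      by (intro less_imp_le foldr_dir_deriv_same_sign[OF A]) (auto simp: tilt_pos)
  qed
  ultimately have "foldr dir_deriv vs A 0 * A \<beta> \<ge> 0"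
    using L by (auto intro: tendsto_lowerbound)
  \<comment> \<open>Comparing \<open>vs\<close> with itself shows that the square of the value is
    positive.\<close>
  moreover have "foldr dir_deriv vs A 0 \<noteq> 0"
    using foldr_dir_deriv_same_sign[OF A vs(1) vs(1)] vs(2) by force
  ultimately show ?thesis using \<beta> by (simp add: zero_le_mult_iff)
qed

lemma stable_form_nonneg:
  assumes "stable_form d A" "A \<beta> > 0" "total_degree \<beta> = d" "total_degree \<gamma> = d"
  shows "A \<gamma> \<ge> 0"
proof -
  obtain L where L: "multiindex_of L = \<gamma>" "length L = d" using ex_multiindex_of assms by metis
  have "\<forall>\<^sub>F \<epsilon> in at_right 0. foldr dir_deriv (map (tilt \<epsilon>) L) A 0 \<ge> 0"
    using eventually_at_right_less[of 0]
    by eventually_elim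
      (use L in \<open>auto intro!: less_imp_le foldr_dir_deriv_pos[OF assms(1-3)] simp: tilt_pos\<close>)
  with tendsto_foldr_tilt[of L A 0] show ?thesis
    using L by (auto intro: tendsto_lowerbound)
qed

text \<open>Filling d - 2 slots with positive directions leaves a stable quadratic form; three
  consecutive terms are its polarized values on u and v.\<close>

lemma stable_form_foldr_cross:
  assumes A: "stable_form d A" and \<beta>: "A \<beta> > 0" "total_degree \<beta> = d"
    and vs: "length vs + p = d" "\<And>v m. v \<in> set vs \<Longrightarrow> v m > 0"
    and uv: "\<And>m. u m > 0" "\<And>m. v m > 0"
    and st: "s \<le> t" "t < p"
  defines "x \<equiv> \<lambda>s. foldr dir_deriv (replicate s u @ replicate (p - s) v @ vs) A 0"
  shows "x s * x (Suc t) \<le> x (Suc s) * x t"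
proof (rule log_concave_cross[OF _ _ st])
  show "x s > 0" if "s \<le> p" for s
    unfolding x_def using that vs uv
    by (intro foldr_dir_deriv_pos[OF A \<beta>]) (auto split: if_splits)
  show "x s * x (s + 2) \<le> (x (s + 1))\<^sup>2" if "s + 2 \<le> p" for s
  proof -
    define q where "q = p - s - 2"
    have p: "p = s + 2 + q" using that by (simp add: q_def)
    define C where "C = foldr dir_deriv (replicate s u @ replicate q v @ vs) A"
    have "length (replicate s u @ replicate q v @ vs) + 2 = d" using p vs by simp
    then have C: "stable_form 2 C"
      unfolding C_def using vs uv A
      by (intro stable_form_foldr) (auto simp only: set_append set_replicate_conv_if split: if_splits)
    \<comment> \<open>Here p - s = q + 2, and the two extra copies of \<open>v\<close> are commuted
      to the front.\<close>
    have "x s = dir_deriv v (dir_deriv v C) 0"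
      unfolding x_def C_def by (simp add: dir_deriv_foldr_commute dir_deriv_funpow_commute p)
    moreover have "x (s + 1) = dir_deriv u (dir_deriv v C) 0"
      unfolding x_def C_def by (simp add: dir_deriv_foldr_commute dir_deriv_funpow_commute p)
    moreover have "x (s + 2) = dir_deriv u (dir_deriv u C) 0"
      unfolding x_def C_def by (simp add: p)
    ultimately show ?thesis
      using stable_form_log_concave[OF C uv(2), of u] by (simp add: mult.commute)
  qed
qed

text \<open>The cross inequality itself is passed to the limit: log-concavity of the limit sequence
  alone would not exclude internal zeros.\<close>

lemma stable_form_cross:
  fixes i j :: "'n::finite"
  assumes A: "stable_form d A" and \<beta>: "A \<beta> > 0" "total_degree \<beta> = d"
    and \<rho>: "total_degree \<rho> + p = d" and st: "s \<le> t" "t < p"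
  defines "g \<equiv> \<lambda>s. A (\<rho> + Poly_Mapping.single i s + Poly_Mapping.single j (p - s))"
  shows "g s * g (Suc t) \<le> g (Suc s) * g t"
proof -
  obtain L where L: "multiindex_of L = \<rho>" "length L = total_degree \<rho>" using ex_multiindex_of by metis
  define x where "x = (\<lambda>\<epsilon> s. foldr dir_deriv
    (replicate s (tilt \<epsilon> i) @ replicate (p - s) (tilt \<epsilon> j) @ map (tilt \<epsilon>) L) A 0)"
  have lim: "((\<lambda>\<epsilon>. x \<epsilon> s) \<longlongrightarrow> g s) (at_right 0)" for s
    using tendsto_foldr_tilt[of "replicate s i @ replicate (p - s) j @ L" A 0] L
    by (simp add: x_def g_def ac_simps)
  have ev: "\<forall>\<^sub>F \<epsilon> in at_right 0. x \<epsilon> s * x \<epsilon> (Suc t) \<le> x \<epsilon> (Suc s) * x \<epsilon> t"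
    using eventually_at_right_less[of 0]
  proof eventually_elim
    case (elim \<epsilon>)
    show ?case
      unfolding x_def using L \<rho> elim
      by (intro stable_form_foldr_cross[OF A \<beta> _ _ _ _ st]) (auto simp: tilt_pos)
  qed
  show ?thesis
    by (rule tendsto_le[OF _ tendsto_mult[OF lim lim] tendsto_mult[OF lim lim] ev]) simp
qed

section \<open>Evaluation of f as an iterated derivative\<close>

text \<open>The guard \<open>lookup \<gamma> m > 0\<close> is essential: at a zero entry the
  truncated subtraction would return \<gamma> itself.\<close>

lemma dir_deriv_delta:
  "dir_deriv z (\<lambda>\<beta>. of_bool (\<beta> = \<gamma>)) =
    (\<lambda>\<beta>. \<Sum>m\<in>UNIV. (if lookup \<gamma> m > 0 then z m else 0) * of_bool (\<beta> = \<gamma> - Poly_Mapping.single m 1))"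
proof
  fix \<beta>
  have "\<beta> + Poly_Mapping.single m 1 = \<gamma> \<longleftrightarrow> lookup \<gamma> m > 0 \<and> \<beta> = \<gamma> - Poly_Mapping.single m 1" for m
    using multiindex_decomp[of \<gamma> m] by (auto simp: lookup_add)
  then show "dir_deriv z (\<lambda>\<beta>. of_bool (\<beta> = \<gamma>)) \<beta> =
      (\<Sum>m\<in>UNIV. (if lookup \<gamma> m > 0 then z m else 0) * of_bool (\<beta> = \<gamma> - Poly_Mapping.single m 1))"
    unfolding dir_deriv_def by (intro sum.cong) (auto simp del: One_nat_def)
qed

text \<open>Each m contributes \<gamma>_m times one common quantity, and these entries sum to k + 1,
  which turns k! into (k + 1)!.\<close>

lemma dir_deriv_funpow_delta:
  fixes z :: "'n::finite \<Rightarrow> 'a::field_char_0"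
  assumes "total_degree \<gamma> = k"
  shows "(dir_deriv z ^^ k) (\<lambda>\<beta>. of_bool (\<beta> = \<gamma>)) 0 =
    fact k * (\<Prod>m\<in>UNIV. z m ^ lookup \<gamma> m / fact (lookup \<gamma> m))"
  using assms
proof (induction k arbitrary: \<gamma>)
  case 0
  then have "\<gamma> = 0" by (intro poly_mapping_eqI) (simp add: total_degree_def)
  then show ?case by simp
next
  case (Suc k)
  define T where "T \<gamma> = (\<Prod>m\<in>UNIV. z m ^ lookup \<gamma> m / fact (lookup \<gamma> m))" for \<gamma> :: "'n multiindex"
  have summand: "(if lookup \<gamma> m > 0 then z m else 0) *
      (dir_deriv z ^^ k) (\<lambda>\<beta>. of_bool (\<beta> = \<gamma> - Poly_Mapping.single m 1)) 0 =
      fact k * T \<gamma> * of_nat (lookup \<gamma> m)" for m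
  proof (cases "lookup \<gamma> m > 0")
    case True
    let ?\<delta> = "\<gamma> - Poly_Mapping.single m 1"
    have \<gamma>: "?\<delta> + Poly_Mapping.single m 1 = \<gamma>" using multiindex_decomp[OF True] .
    then have "total_degree ?\<delta> + 1 = Suc k"
      using Suc.prems by (metis total_degree_add total_degree_single)
    then have IH: "(dir_deriv z ^^ k) (\<lambda>\<beta>. of_bool (\<beta> = ?\<delta>)) 0 = fact k * T ?\<delta>"
      unfolding T_def by (intro Suc.IH) simp
    obtain r where r: "lookup \<gamma> m = Suc r" using True by (cases "lookup \<gamma> m") auto
    have rest: "(\<Prod>l\<in>UNIV - {m}. z l ^ lookup ?\<delta> l / fact (lookup ?\<delta> l)) =
        (\<Prod>l\<in>UNIV - {m}. z l ^ lookup \<gamma> l / fact (lookup \<gamma> l))"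
      by (intro prod.cong) (auto simp: lookup_minus lookup_single)
    have "z m * T ?\<delta> = of_nat (lookup \<gamma> m) * T \<gamma>"
      unfolding T_def prod.remove[OF finite UNIV_I, of _ m] rest
      by (simp add: lookup_minus r field_simps del: of_nat_Suc)
    then show ?thesis using True IH by simp
  qed simp
  have "(dir_deriv z ^^ Suc k) (\<lambda>\<beta>. of_bool (\<beta> = \<gamma>)) 0 =
      (\<Sum>m\<in>UNIV. (if lookup \<gamma> m > 0 then z m else 0) *
        (dir_deriv z ^^ k) (\<lambda>\<beta>. of_bool (\<beta> = \<gamma> - Poly_Mapping.single m 1)) 0)"
    unfolding funpow_Suc_right o_apply dir_deriv_delta dir_deriv_funpow_sum ..
  also have "\<dots> = fact k * T \<gamma> * of_nat (total_degree \<gamma>)"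
    unfolding summand by (simp add: total_degree_def sum_distrib_left)
  also have "\<dots> = fact (Suc k) * T \<gamma>"
    using Suc.prems by (simp add: algebra_simps)
  finally show ?case unfolding T_def .
qed

text \<open>Both sides are linear in the coefficients, so point masses suffice; there the
  multinomial coefficient cancels the normalization.\<close>

lemma ceval_eq_dir_deriv:
  assumes "homogeneous d f"
  shows "ceval f z = (dir_deriv z ^^ d) (\<lambda>\<gamma>. complex_of_real (normalized_coeff d f \<gamma>)) 0"
proof -
  let ?K = "Poly_Mapping.keys f"
  let ?A = "\<lambda>\<gamma>. complex_of_real (normalized_coeff d f \<gamma>)"
  have A: "?A = (\<lambda>\<gamma>. \<Sum>\<beta>\<in>?K. ?A \<beta> * of_bool (\<gamma> = \<beta>))"
  proof
    fix \<gamma>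
    show "?A \<gamma> = (\<Sum>\<beta>\<in>?K. ?A \<beta> * of_bool (\<gamma> = \<beta>))"
    proof (cases "\<gamma> \<in> ?K")
      case True
      then show ?thesis by (simp add: of_bool_def if_distrib sum.delta cong: if_cong)
    next
      case False
      then have "(\<Sum>\<beta>\<in>?K. ?A \<beta> * of_bool (\<gamma> = \<beta>)) = 0" by (intro sum.neutral) auto
      then show ?thesis using False by (simp add: normalized_coeff_def in_keys_iff)
    qed
  qed
  have "(dir_deriv z ^^ d) ?A 0 = (\<Sum>\<beta>\<in>?K. ?A \<beta> * (dir_deriv z ^^ d) (\<lambda>\<gamma>. of_bool (\<gamma> = \<beta>)) 0)"
    by (subst A) (simp only: dir_deriv_funpow_sum)
  also have "\<dots> = ceval f z"
    unfolding ceval_def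
  proof (intro sum.cong refl)
    fix \<beta> assume "\<beta> \<in> ?K"
    then have "total_degree \<beta> = d" using assms by (simp add: homogeneous_def)
    from dir_deriv_funpow_delta[OF this, of z]
    show "?A \<beta> * (dir_deriv z ^^ d) (\<lambda>\<gamma>. of_bool (\<gamma> = \<beta>)) 0 =
        complex_of_real (lookup f \<beta>) * (\<Prod>i\<in>UNIV. z i ^ lookup \<beta> i)"
      by (simp add: normalized_coeff_def multinomial_def prod_dividef of_real_prod)
  qed
  finally show ?thesis ..
qed

section \<open>Symmetry and the final inequalities\<close>

lemma normalized_coeff_map_key:
  assumes "symmetric f" "bij \<pi>"
  shows "normalized_coeff d f (Poly_Mapping.map_key \<pi> \<alpha>) = normalized_coeff d f \<alpha>"
proof -
  have "lookup f (Poly_Mapping.map_key \<pi> \<alpha>) = lookup f \<alpha>"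
    using assms lookup_permute_vars(1)[OF assms(2), of f \<alpha>] by (simp add: symmetric_def)
  moreover have "(\<Prod>m\<in>UNIV. fact (lookup \<alpha> (\<pi> m))) = (\<Prod>m\<in>UNIV. fact (lookup \<alpha> m) :: real)"
    using prod.reindex_bij_betw[OF assms(2), of "\<lambda>m. fact (lookup \<alpha> m) :: real"] by simp
  ultimately show ?thesis
    by (simp add: normalized_coeff_def multinomial_def lookup_permute_vars(2)[OF assms(2)])
qed

theorem corollary3p3:
  fixes f :: "('n::finite) real_mpoly" and d :: nat
    and \<alpha> :: "'n multiindex" and i j :: 'n
  assumes "homogeneous d f"
    and "symmetric f"
    and "\<exists>\<beta>. lookup f \<beta> > 0"
    and "real_stable f"
    and "total_degree \<alpha> = d"
    and "lookup \<alpha> i \<ge> lookup \<alpha> j"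
  shows "(\<forall>k l :: int.
            - int (lookup \<alpha> i) \<le> k \<and> k \<le> l \<and> l \<le> \<lfloor>(real (lookup \<alpha> j) - real (lookup \<alpha> i)) / 2\<rfloor>
            \<longrightarrow> normalized_coeff d f (shift \<alpha> k i j) \<le> normalized_coeff d f (shift \<alpha> l i j))
       \<and> (\<forall>k l :: int.
            \<lfloor>(real (lookup \<alpha> j) - real (lookup \<alpha> i)) / 2\<rfloor> \<le> k \<and> k \<le> l \<and> l \<le> int (lookup \<alpha> j)
            \<longrightarrow> normalized_coeff d f (shift \<alpha> k i j) \<ge> normalized_coeff d f (shift \<alpha> l i j))"
proof -
  have floor_eq: "\<lfloor>(real (lookup \<alpha> j) - real (lookup \<alpha> i)) / 2\<rfloor> = (int (lookup \<alpha> j) - int (lookup \<alpha> i)) div 2"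
    using floor_divide_of_int_eq[of "int (lookup \<alpha> j) - int (lookup \<alpha> i)" 2, where ?'a = real] by simp
  show ?thesis
  proof (cases "i = j")
    case True
    have "shift \<alpha> k i j = \<alpha>" if "- int (lookup \<alpha> i) \<le> k" "k \<le> int (lookup \<alpha> j)" for k
      using int_lookup_shift[OF that] True by (intro poly_mapping_eqI) simp
    then show ?thesis using True by auto
  next
    case False
    define A where "A = normalized_coeff d f"
    \<comment> \<open>Along \<alpha> + k(e_i - e_j) only the entries at i and j move, with fixed sum
      \<open>p\<close>, while \<open>\<rho>\<close> holds the others. The new parameter s =
      \<alpha>_i + k runs from 0 to \<open>p\<close>.\<close>
    define p where "p = lookup \<alpha> i + lookup \<alpha> j"
    define \<rho> where "\<rho> = \<alpha> - Poly_Mapping.single i (lookup \<alpha> i) - Poly_Mapping.single j (lookup \<alpha> j)"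
    define ix where "ix s = \<rho> + Poly_Mapping.single i s + Poly_Mapping.single j (p - s)" for s
    have \<alpha>: "\<alpha> = \<rho> + Poly_Mapping.single i (lookup \<alpha> i) + Poly_Mapping.single j (lookup \<alpha> j)"
      unfolding \<rho>_def using False
      by (intro poly_mapping_eqI) (auto simp: lookup_add lookup_minus lookup_single when_def)
    have deg: "total_degree \<rho> + p = d"
      using arg_cong[OF \<alpha>, of total_degree] assms(5)
      by (simp add: total_degree_add total_degree_single p_def)
    have stable: "stable_form d A"
      using assms(4) ceval_eq_dir_deriv[OF assms(1)]
      by (simp add: stable_form_def real_stable_def A_def)
    obtain \<beta> where \<beta>: "lookup f \<beta> > 0" using assms(3) by blast
    then have "total_degree \<beta> = d" using assms(1) by (simp add: homogeneous_def in_keys_iff)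
    moreover have "A \<beta> > 0"
      using \<beta> by (simp add: A_def normalized_coeff_def multinomial_def prod_pos)
    ultimately have pos: "A \<beta> > 0" "total_degree \<beta> = d" by auto
    \<comment> \<open>Swapping i and j reflects the line by s \<mapsto> p - s.\<close>
    define \<pi> where "\<pi> = id(i := j, j := i)"
    have \<pi>: "bij \<pi>" by (rule involuntory_imp_bij) (auto simp: \<pi>_def)
    have nonneg: "A (ix s) \<ge> 0" if "s \<le> p" for s
      using that deg
      by (intro stable_form_nonneg[OF stable pos]) (simp add: ix_def total_degree_add total_degree_single)
    have sym: "A (ix (p - s)) = A (ix s)" if "s \<le> p" for s
    proof -
      have "Poly_Mapping.map_key \<pi> (ix s) = ix (p - s)"
        using that False
        by (intro poly_mapping_eqI, unfold lookup_permute_vars(2)[OF \<pi>])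
          (auto simp: ix_def \<rho>_def \<pi>_def lookup_add lookup_minus lookup_single when_def)
      then show ?thesis
        using normalized_coeff_map_key[OF assms(2) \<pi>, of d "ix s"] by (simp add: A_def)
    qed
    have cross: "A (ix s) * A (ix (Suc t)) \<le> A (ix (Suc s)) * A (ix t)" if "s \<le> t" "t < p" for s t
      unfolding ix_def by (rule stable_form_cross[OF stable pos deg that])
    have shift: "shift \<alpha> k i j = ix (nat (int (lookup \<alpha> i) + k))"
      if k: "- int (lookup \<alpha> i) \<le> k" "k \<le> int (lookup \<alpha> j)" for k
    proof (rule poly_mapping_eqI)
      fix m
      have "int (lookup (shift \<alpha> k i j) m) = int (lookup (ix (nat (int (lookup \<alpha> i) + k))) m)"
        unfolding int_lookup_shift[OF k] using k False
        by (auto simp: ix_def \<rho>_def p_def lookup_add lookup_minus lookup_single when_def)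
      then show "lookup (shift \<alpha> k i j) m = lookup (ix (nat (int (lookup \<alpha> i) + k))) m" by simp
    qed
    note mono = symmetric_unimodal[of p "\<lambda>s. A (ix s)", OF nonneg sym cross]
    show ?thesis
      unfolding floor_eq A_def[symmetric]
    proof (intro conjI allI impI; elim conjE)
      fix k l :: int
      assume kl: "- int (lookup \<alpha> i) \<le> k" "k \<le> l" "l \<le> (int (lookup \<alpha> j) - int (lookup \<alpha> i)) div 2"
      \<comment> \<open>For t = \<alpha>_i + l the upper bound on \<open>l\<close> says 2 t \<le>
        p.\<close>
      have "A (ix (nat (int (lookup \<alpha> i) + k))) \<le> A (ix (nat (int (lookup \<alpha> i) + l)))"
        by (rule mono(1)) (use kl in \<open>auto simp: p_def\<close>)
      then show "A (shift \<alpha> k i j) \<le> A (shift \<alpha> l i j)"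
        using kl assms(6) by (subst (1 2) shift) auto
    next
      fix k l :: int
      assume kl: "(int (lookup \<alpha> j) - int (lookup \<alpha> i)) div 2 \<le> k" "k \<le> l" "l \<le> int (lookup \<alpha> j)"
      \<comment> \<open>For s = \<alpha>_i + k the lower bound on \<open>k\<close> says p \<le> 2 s
        + 1; the extra 1 comes from the floor.\<close>
      have "A (ix (nat (int (lookup \<alpha> i) + l))) \<le> A (ix (nat (int (lookup \<alpha> i) + k)))"
        by (rule mono(2)) (use kl in \<open>auto simp: p_def\<close>)
      then show "A (shift \<alpha> l i j) \<le> A (shift \<alpha> k i j)"
        using kl assms(6) by (subst (1 2) shift) auto
    qed
  qed
qed

end
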